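(* Let $\alpha_2,\beta_2$ be real numbers. The double inequality $$\alpha_2G(a,b)+(1-\alpha_2)Q(a,b)<M(a,b)<\beta_2G(a,b)+(1-\beta_2)Q(a,b)$$ holds for all $a,b>0$ with $a\neq b$ if and only if $\alpha_2\geq \frac{1}{3}=0.3333\cdots$ and $\beta_2\leq 1-\frac{1}{\sqrt{2}\log(1+\sqrt{2})}=0.1977\cdots$.
   Context: For real numbers $a,b>0$ with $a\neq b$: the geometric mean is $G(a,b)=\sqrt{ab}$; the quadratic mean is $Q(a,b)=\sqrt{\frac{a^2+b^2}{2}}$; the Neuman-Sándor mean is $M(a,b)=\frac{a-b}{2\sinh^{-1}\left(\frac{a-b}{a+b}\right)}$, where $\sinh^{-1}(x)=\log(x+\sqrt{1+x^2})$ is the inverse hyperbolic sine function. Here $\log$ is the natural logarithm. *)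

theory Defs
  imports Complex_Main
begin

definition geometric_mean :: "real \<Rightarrow> real \<Rightarrow> real" where
  "geometric_mean a b = sqrt (a * b)"

definition quadratic_mean :: "real \<Rightarrow> real \<Rightarrow> real" where
  "quadratic_mean a b = sqrt ((a\<^sup>2 + b\<^sup>2) / 2)"

(* Only meaningful for positive a and b with a \<noteq> b: at a = b the quotient is 0 / 0 = 0. *)
definition neuman_sandor_mean :: "real \<Rightarrow> real \<Rightarrow> real" where
  "neuman_sandor_mean a b = (a - b) / (2 * arsinh ((a - b) / (a + b)))"

end

theory Submission
  imports Defs
begin

text \<open>
  All three means are homogeneous and symmetric, so dividing by \<open>A = (a + b) / 2\<close> and putting
  \<open>x = \<bar>a - b\<bar> / (a + b)\<close>, which ranges over all of \<open>(0, 1)\<close>, turns \<open>G\<close>, \<open>Q\<close> and \<open>M\<close> into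
  \<open>u = sqrt (1 - x\<^sup>2)\<close>, \<open>v = sqrt (1 + x\<^sup>2)\<close> and \<open>x / arsinh x\<close>.  The mean \<open>M\<close> lies below or above
  the mixture \<open>l G + (1 - l) Q\<close> according to the sign of
  \<open>gap l x = arsinh x - x / (l u + (1 - l) v)\<close>, and \<open>gap l 0 = 0\<close>.

  Everything rests on the derivative of the gap.  Because \<open>u\<^sup>2 + v\<^sup>2 = 2\<close>, its numerator is homogeneous
  in \<open>u\<close> and \<open>v\<close>, hence up to a positive factor a polynomial in \<open>t = v / u\<close>.  This cubic vanishes at
  \<open>t = 1\<close> (that is, \<open>x = 0\<close>), and since \<open>v > u\<close> the sign of the derivative is that of a quadratic in
  \<open>t\<close>, called \<open>slope_factor l\<close> below, with \<open>slope_factor l 1 = 2 - 6 l\<close>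
  (lemma \<open>gap_has_real_derivative\<close>).  As \<open>t\<close> increases from \<open>1\<close> to \<open>\<infinity>\<close>, three cases settle the theorem:

  \<^item> For \<open>l = 1/3\<close> the quadratic is \<open>- (t - 1) (3 t + 4) / 9 < 0\<close>, so the gap is negative on \<open>(0, 1]\<close>.

  \<^item> For \<open>l < 1/3\<close> the quadratic is positive near \<open>t = 1\<close>, so the gap is positive near \<open>x = 0\<close>.
    Thus \<open>1/3\<close> is the best constant in the lower bound.

  \<^item> The constant \<open>1 - 1 / (sqrt 2 * ln (1 + sqrt 2))\<close>, called \<open>end_weight\<close>, is the weight whose gap
    also vanishes at \<open>x = 1\<close>.  It lies in \<open>(0, 1/3)\<close>, so its quadratic is concave and positive at \<open>t = 1\<close>
    and changes sign at most once.  The gap first increases and then decreases, and being zero at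
    both ends it is positive between them.  Letting \<open>x\<close> tend to \<open>1\<close> in the upper bound shows that no
    larger weight is possible.
\<close>

section \<open>The one-variable form of the inequality\<close>

definition mix :: "real \<Rightarrow> real \<Rightarrow> real" where
  "mix l x = l * sqrt (1 - x\<^sup>2) + (1 - l) * sqrt (1 + x\<^sup>2)"

definition gap :: "real \<Rightarrow> real \<Rightarrow> real" where
  "gap l x = arsinh x - x / mix l x"

text \<open>
  The absolute value in \<open>x\<close> is harmless for \<open>M\<close>: both \<open>a - b\<close> and \<open>arsinh\<close> are odd, so their quotient
  is even.
\<close>

lemma means_normalized:
  assumes "0 < a" "0 < b" "a \<noteq> b"
  defines "A \<equiv> (a + b) / 2" and "x \<equiv> \<bar>a - b\<bar> / (a + b)"
  shows "0 < A" "0 < x" "x < 1"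
    and "l * geometric_mean a b + (1 - l) * quadratic_mean a b = A * mix l x"
    and "neuman_sandor_mean a b = A * (x / arsinh x)"
proof -
  show A: "0 < A" and "0 < x" "x < 1" using assms by (auto simp: A_def x_def)
  have x2: "A\<^sup>2 * x\<^sup>2 = (a - b)\<^sup>2 / 4"
    using assms by (simp add: A_def x_def power_divide)
  have "a * b = A\<^sup>2 * (1 - x\<^sup>2)"
    by (simp add: right_diff_distrib x2) (simp add: A_def power2_eq_square field_simps)
  then have G: "geometric_mean a b = A * sqrt (1 - x\<^sup>2)"
    using A by (simp add: geometric_mean_def real_sqrt_mult)
  have "(a\<^sup>2 + b\<^sup>2) / 2 = A\<^sup>2 * (1 + x\<^sup>2)"
    by (simp add: distrib_left x2) (simp add: A_def power2_eq_square field_simps)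
  then have Q: "quadratic_mean a b = A * sqrt (1 + x\<^sup>2)"
    using A by (simp add: quadratic_mean_def real_sqrt_mult)
  show "l * geometric_mean a b + (1 - l) * quadratic_mean a b = A * mix l x"
    by (simp add: G Q mix_def algebra_simps)
  have "x * (a + b) = \<bar>a - b\<bar>" using assms by (simp add: x_def)
  then have "2 * (A * x) = \<bar>a - b\<bar>" by (simp add: A_def mult.commute)
  then have "a - b = sgn (a - b) * (2 * (A * x))" by (simp add: sgn_mult_abs)
  moreover have "(a - b) / (a + b) = sgn (a - b) * x"
    by (simp add: x_def sgn_mult_abs)
  ultimately have "neuman_sandor_mean a b
      = sgn (a - b) * (2 * (A * x)) / (2 * arsinh (sgn (a - b) * x))"
    by (simp only: neuman_sandor_mean_def)
  then show "neuman_sandor_mean a b = A * (x / arsinh x)"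
    using \<open>a \<noteq> b\<close> by (cases "a < b") auto
qed

text \<open>The pair \<open>a = 1 + x\<close>, \<open>b = 1 - x\<close> realizes any given \<open>x\<close> in \<open>(0, 1)\<close>, with \<open>A = 1\<close>.\<close>

lemma double_inequality_iff_mix:
  "(\<forall>a b :: real. a > 0 \<longrightarrow> b > 0 \<longrightarrow> a \<noteq> b \<longrightarrow>
      \<alpha> * geometric_mean a b + (1 - \<alpha>) * quadratic_mean a b < neuman_sandor_mean a b \<and>
      neuman_sandor_mean a b < \<beta> * geometric_mean a b + (1 - \<beta>) * quadratic_mean a b)
   \<longleftrightarrow> (\<forall>x. 0 < x \<longrightarrow> x < 1 \<longrightarrow> mix \<alpha> x < x / arsinh x \<and> x / arsinh x < mix \<beta> x)"
  (is "?means \<longleftrightarrow> ?profile")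
proof
  assume ?means
  show ?profile
  proof (intro allI impI)
    fix x :: real assume x: "0 < x" "x < 1"
    then show "mix \<alpha> x < x / arsinh x \<and> x / arsinh x < mix \<beta> x"
      using \<open>?means\<close>[rule_format, of "1 + x" "1 - x"] means_normalized(4,5)[of "1 + x" "1 - x"]
      by simp
  qed
next
  assume ?profile
  show ?means
  proof (intro allI impI)
    fix a b :: real assume ab: "0 < a" "0 < b" "a \<noteq> b"
    note normalized = means_normalized[OF ab]
    show "\<alpha> * geometric_mean a b + (1 - \<alpha>) * quadratic_mean a b < neuman_sandor_mean a b \<and>
        neuman_sandor_mean a b < \<beta> * geometric_mean a b + (1 - \<beta>) * quadratic_mean a b"
      unfolding normalized(4,5) mult_less_cancel_left_pos[OF normalized(1)]
      using \<open>?profile\<close> normalized(2,3) by blast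
  qed
qed

lemma mix_antimono: "l \<le> m \<Longrightarrow> mix m x \<le> mix l x"
proof -
  assume "l \<le> m"
  have "sqrt (1 - x\<^sup>2) \<le> sqrt (1 + x\<^sup>2)" by simp
  then have "0 \<le> (m - l) * (sqrt (1 + x\<^sup>2) - sqrt (1 - x\<^sup>2))"
    using \<open>l \<le> m\<close> by simp
  then show ?thesis by (simp add: mix_def algebra_simps)
qed

text \<open>
  For negative \<open>l\<close> the first summand is nonpositive, but then monotonicity in the weight gives the bound
  \<open>mix l x \<ge> mix 0 x > 0\<close>.
\<close>

lemma mix_pos:
  assumes "l < 1" "0 \<le> x" "x \<le> 1"
  shows "0 < mix l x"
proof (cases "0 \<le> l")
  case True
  have "0 \<le> sqrt (1 - x\<^sup>2)" using assms by (simp add: power_le_one)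
  moreover have "0 < sqrt (1 + x\<^sup>2)" by (simp add: add_pos_nonneg)
  ultimately show ?thesis using True assms by (simp add: mix_def add_nonneg_pos)
next
  case False
  have "0 < sqrt (1 + x\<^sup>2)" by (simp add: add_pos_nonneg)
  also have "\<dots> = mix 0 x" by (simp add: mix_def)
  also have "\<dots> \<le> mix l x" using False by (intro mix_antimono) simp
  finally show ?thesis .
qed

lemma quotient_arsinh_less_mix_iff:
  assumes "l < 1" "0 < x" "x \<le> 1"
  shows "x / arsinh x < mix l x \<longleftrightarrow> 0 < gap l x"
    and "mix l x < x / arsinh x \<longleftrightarrow> gap l x < 0"
  using mix_pos[of l x] assms by (auto simp: gap_def field_simps)

section \<open>The sign of the derivative of the gap\<close>

definition tilt :: "real \<Rightarrow> real" where
  "tilt x = sqrt (1 + x\<^sup>2) / sqrt (1 - x\<^sup>2)"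

text \<open>
  The quotient of the cubic \<open>2 (l + (1 - l) t)\<^sup>2 - (l t + (1 - l)) (1 + t\<^sup>2)\<close> by \<open>t - 1\<close>.
\<close>

definition slope_factor :: "real \<Rightarrow> real \<Rightarrow> real" where
  "slope_factor l t = - l * t\<^sup>2 + (2 * (1 - l)\<^sup>2 - 1) * t + (1 - l - 2 * l\<^sup>2)"

lemma square_less_one: "0 \<le> x \<Longrightarrow> x < 1 \<Longrightarrow> x\<^sup>2 < 1" for x :: real
  by (simp add: power_less_one_iff abs_square_less_1)

lemma tilt_gt_1: "0 < x \<Longrightarrow> x < 1 \<Longrightarrow> 1 < tilt x"
  using square_less_one[of x] by (simp add: tilt_def)

lemma tilt_less:
  assumes "0 < x" "x < y" "y < 1"
  shows "tilt x < tilt y"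
proof -
  have "x\<^sup>2 < y\<^sup>2" "y\<^sup>2 < 1"
    using assms square_less_one[of y] by (auto simp: power_strict_mono)
  then have "sqrt (1 + x\<^sup>2) < sqrt (1 + y\<^sup>2)" "sqrt (1 - y\<^sup>2) \<le> sqrt (1 - x\<^sup>2)" "0 < sqrt (1 - y\<^sup>2)"
    by auto
  then show ?thesis unfolding tilt_def
    by (intro frac_less) auto
qed

text \<open>
  With \<open>w = l u + (1 - l) v\<close> the derivative is \<open>1 / v - (l v + (1 - l) u) / (u v w\<^sup>2)\<close>.  Over the
  denominator \<open>2 u v w\<^sup>2\<close>, replacing a factor \<open>2\<close> by \<open>u\<^sup>2 + v\<^sup>2\<close> makes the
  numerator homogeneous of degree three in \<open>u\<close> and \<open>v\<close>, so that the factor \<open>v - u\<close> splits off.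
\<close>

lemma gap_has_real_derivative:
  assumes "l < 1" "0 < x" "x < 1"
  shows "\<exists>c > 0. (gap l has_real_derivative c * slope_factor l (tilt x)) (at x)"
proof -
  define u v where "u = sqrt (1 - x\<^sup>2)" and "v = sqrt (1 + x\<^sup>2)"
  define w where "w = l * u + (1 - l) * v"
  have x2: "x\<^sup>2 < 1" using square_less_one[of x] assms by simp
  have u: "0 < u" "u\<^sup>2 = 1 - x\<^sup>2" using x2 by (auto simp: u_def)
  have v: "0 < v" "v\<^sup>2 = 1 + x\<^sup>2" by (auto simp: v_def add_pos_nonneg)
  have w: "0 < w" using mix_pos[of l x] assms by (simp add: w_def u_def v_def mix_def)
  have tilt: "tilt x = v / u" by (simp add: tilt_def u_def v_def)
  have vu: "u < v" using assms by (simp add: u_def v_def)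
  let ?c = "(v - u) * u / (2 * v * w\<^sup>2)"
  have du: "((\<lambda>x. sqrt (1 - x\<^sup>2)) has_real_derivative - x / u) (at x)"
    unfolding u_def using x2
    by (auto intro!: derivative_eq_intros simp: field_simps)
  have dv: "((\<lambda>x. sqrt (1 + x\<^sup>2)) has_real_derivative x / v) (at x)"
    unfolding v_def
    by (rule DERIV_chain2[OF DERIV_real_sqrt, THEN DERIV_cong])
       (auto intro!: derivative_eq_intros simp: add_pos_nonneg field_simps)
  have dm: "(mix l has_real_derivative l * (- x / u) + (1 - l) * (x / v)) (at x)"
    unfolding mix_def[abs_def] by (intro DERIV_add DERIV_cmult du dv)
  have m: "mix l x = w" by (simp add: mix_def w_def u_def v_def)
  have dg: "(gap l has_real_derivative
      1 / v - (w - x * (l * (- x / u) + (1 - l) * (x / v))) / (w * w)) (at x)"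
    unfolding gap_def[abs_def]
    using w dm m
    by (auto intro!: derivative_eq_intros simp: v_def add.commute)
  have e1: "w - x * (l * (- x / u) + (1 - l) * (x / v)) = (l * v + (1 - l) * u) / (u * v)"
  proof -
    have "w - x * (l * (- x / u) + (1 - l) * (x / v))
        = (l * v * (u\<^sup>2 + x\<^sup>2) + (1 - l) * u * (v\<^sup>2 - x\<^sup>2)) / (u * v)"
      using u(1) v(1) by (simp add: w_def field_simps power2_eq_square)
    then show ?thesis using u v by simp
  qed
  have P: "2 * u * w\<^sup>2 - (l * v + (1 - l) * u) * (u\<^sup>2 + v\<^sup>2)
      = (v - u) * (- l * v\<^sup>2 + (2 * (1 - l)\<^sup>2 - 1) * (u * v) + (1 - l - 2 * l\<^sup>2) * u\<^sup>2)"
    unfolding w_def by algebra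
  have s: "u\<^sup>2 * slope_factor l (v / u)
      = - l * v\<^sup>2 + (2 * (1 - l)\<^sup>2 - 1) * (u * v) + (1 - l - 2 * l\<^sup>2) * u\<^sup>2"
    using u(1) by (simp add: slope_factor_def field_simps power2_eq_square)
  have "1 / v - (w - x * (l * (- x / u) + (1 - l) * (x / v))) / (w * w)
      = (2 * u * w\<^sup>2 - (l * v + (1 - l) * u) * (u\<^sup>2 + v\<^sup>2)) / (2 * u * v * w\<^sup>2)"
    unfolding e1 using u v w by (simp add: field_simps power2_eq_square)
  also have "\<dots> = (v - u) * (u\<^sup>2 * slope_factor l (v / u)) / (2 * u * v * w\<^sup>2)"
    by (simp only: P s)
  also have "\<dots> = ?c * slope_factor l (tilt x)"
    using u(1) v(1) w by (simp add: tilt power2_eq_square)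
  finally have "(gap l has_real_derivative ?c * slope_factor l (tilt x)) (at x)"
    using dg by simp
  moreover have "0 < ?c" using u v w vu by simp
  ultimately show ?thesis by blast
qed

lemma continuous_on_gap:
  assumes "l < 1"
  shows "continuous_on {0..1} (gap l)"
proof -
  have "continuous_on {0..1} (mix l)"
    unfolding mix_def[abs_def] by (intro continuous_intros)
  moreover have "\<forall>x\<in>{0..1}. mix l x \<noteq> 0"
    using mix_pos[OF assms] by force
  ultimately show ?thesis
    unfolding gap_def[abs_def] by (intro continuous_intros) auto
qed

lemma gap_less:
  assumes "l < 1" "0 \<le> x" "x < y" "y \<le> 1"
    and "\<And>z. x < z \<Longrightarrow> z < y \<Longrightarrow> slope_factor l (tilt z) < 0"
  shows "gap l y < gap l x"
proof (rule DERIV_neg_imp_decreasing_open[where f = "gap l"])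
  show "\<exists>d. (gap l has_real_derivative d) (at z) \<and> d < 0" if "x < z" "z < y" for z
    using gap_has_real_derivative[of l z] assms that by (fastforce intro: mult_pos_neg)
  show "continuous_on {x..y} (gap l)"
    using continuous_on_gap[of l] assms by (auto elim: continuous_on_subset)
qed fact

lemma gap_greater:
  assumes "l < 1" "0 \<le> x" "x < y" "y \<le> 1"
    and "\<And>z. x < z \<Longrightarrow> z < y \<Longrightarrow> 0 < slope_factor l (tilt z)"
  shows "gap l x < gap l y"
proof (rule DERIV_pos_imp_increasing_open[where f = "gap l"])
  show "\<exists>d. (gap l has_real_derivative d) (at z) \<and> d > 0" if "x < z" "z < y" for z
    using gap_has_real_derivative[of l z] assms that by (fastforce intro: mult_pos_pos)
  show "continuous_on {x..y} (gap l)"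
    using continuous_on_gap[of l] assms by (auto elim: continuous_on_subset)
qed fact

lemma gap_0 [simp]: "gap l 0 = 0"
  by (simp add: gap_def)

section \<open>The weight one third and smaller weights\<close>

text \<open>
  At this weight the slope factor itself has the root \<open>t = 1\<close>, and so it keeps one sign for \<open>t > 1\<close>.
  The endpoint \<open>x = 1\<close> is included because its instance yields \<open>end_weight < 1/3\<close>.
\<close>

lemma gap_third_neg:
  assumes "0 < x" "x \<le> 1"
  shows "gap (1/3) x < 0"
proof -
  have "gap (1/3) x < gap (1/3) 0"
  proof (rule gap_less)
    fix z assume "0 < z" "z < x"
    then have "1 < tilt z" using assms by (simp add: tilt_gt_1)
    then have "0 < (tilt z - 1) * (3 * tilt z + 4)" by simp
    then show "slope_factor (1/3) (tilt z) < 0"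
      by (simp add: slope_factor_def field_simps power2_eq_square)
  qed (use assms in auto)
  then show ?thesis by simp
qed

lemma slope_factor_1: "slope_factor l 1 = 2 - 6 * l"
  by (simp add: slope_factor_def power2_eq_square algebra_simps)

text \<open>
  The slope factor is positive at \<open>t = 1 = tilt 0\<close>, hence by continuity along the whole of some interval
  \<open>(0, d)\<close>, and the gap increases there from \<open>gap l 0 = 0\<close>.
\<close>

lemma gap_pos_near_0:
  assumes "l < 1/3"
  shows "\<exists>x. 0 < x \<and> x < 1 \<and> 0 < gap l x"
proof -
  have "isCont (\<lambda>x. slope_factor l (tilt x)) 0"
    unfolding slope_factor_def tilt_def by (intro continuous_intros) auto
  moreover have "0 < slope_factor l (tilt 0)"
    using assms by (simp add: tilt_def slope_factor_1)
  ultimately have "\<forall>\<^sub>F x in at 0. 0 < slope_factor l (tilt x)"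
    by (auto simp: isCont_def intro: order_tendstoD)
  then obtain d where d: "0 < d" "\<And>x. x \<noteq> 0 \<Longrightarrow> \<bar>x\<bar> < d \<Longrightarrow> 0 < slope_factor l (tilt x)"
    by (auto simp: eventually_at dist_real_def)
  define x where "x = min d (1/2)"
  have "gap l 0 < gap l x"
    using assms d by (intro gap_greater) (auto simp: x_def)
  then show ?thesis using d(1) by (intro exI[of _ x]) (auto simp: x_def)
qed

section \<open>The weight whose gap vanishes at one\<close>

lemma arsinh_1: "arsinh 1 = ln (1 + sqrt 2)"
  by (simp add: arsinh_real_def add.commute)

definition end_weight :: real where
  "end_weight = 1 - 1 / (sqrt 2 * ln (1 + sqrt 2))"

lemma mix_1: "mix l 1 = (1 - l) * sqrt 2"
  by (simp add: mix_def)

lemma inverse_arsinh_1: "1 / arsinh 1 = (1 - end_weight) * sqrt 2"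
  by (simp add: end_weight_def arsinh_1)

text \<open>
  This amounts to \<open>arsinh 1 > 1 / sqrt 2\<close>, which holds because the derivative \<open>1 / sqrt (z\<^sup>2 + 1)\<close> of
  \<open>arsinh\<close> exceeds \<open>1 / sqrt 2\<close> on \<open>[0, 1)\<close>.
\<close>

lemma end_weight_pos: "0 < end_weight"
proof -
  have "\<exists>z::real. 0 < z \<and> z < 1 \<and> arsinh 1 - arsinh 0 = (1 - 0) * (1 / sqrt (z\<^sup>2 + 1))"
    by (rule MVT2) (auto intro!: derivative_eq_intros)
  then obtain z :: real where z: "0 < z" "z < 1" "arsinh 1 = 1 / sqrt (z\<^sup>2 + 1)"
    by auto
  have "sqrt (z\<^sup>2 + 1) < sqrt 2" using square_less_one[of z] z by simp
  then have "1 / arsinh 1 < sqrt 2" using z by simp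
  then show ?thesis unfolding inverse_arsinh_1 by (simp add: algebra_simps zero_less_mult_iff)
qed

text \<open>
  This amounts to an upper bound for \<open>ln (1 + sqrt 2)\<close>, which is the lower bound for \<open>M\<close> at
  \<open>x = 1\<close>: there the quotient \<open>x / arsinh x\<close> equals the mixture with weight
  \<open>end_weight\<close> and exceeds the one with weight \<open>1/3\<close>.
\<close>

lemma end_weight_less_third: "end_weight < 1/3"
  using gap_third_neg[of 1] quotient_arsinh_less_mix_iff(2)[of "1/3" 1] inverse_arsinh_1
  by (simp add: mix_1)

text \<open>
  A concave function that has dropped below its value at \<open>1\<close> keeps decreasing.  Here concavity is used
  through the chord slopes \<open>b - l (t + s)\<close>, which do not increase as the points move to the right.
\<close>

lemma slope_factor_stays_negative:
  assumes "0 \<le> l" "l < 1/3" "1 < s" "s < t" "slope_factor l s \<le> 0"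
  shows "slope_factor l t < 0"
proof -
  define b where "b = 2 * (1 - l)\<^sup>2 - 1"
  have "slope_factor l s < slope_factor l 1" using assms by (simp add: slope_factor_1)
  moreover have factored: "slope_factor l t' - slope_factor l s' = (t' - s') * (b - l * (t' + s'))"
    for s' t' by (simp add: slope_factor_def b_def algebra_simps power2_eq_square)
  ultimately have "(s - 1) * (b - l * (s + 1)) < 0"
    by (simp only: less_iff_diff_less_0[of "slope_factor l s"] factored)
  then have "b - l * (s + 1) < 0" using assms by (simp add: mult_less_0_iff)
  moreover have "l * (s + 1) \<le> l * (t + s)" using assms by (intro mult_left_mono) auto
  ultimately have "(t - s) * (b - l * (t + s)) < 0" using assms by (simp add: mult_less_0_iff)
  then have "slope_factor l t < slope_factor l s"
    using factored[of t s] by simp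
  then show ?thesis using assms by simp
qed

text \<open>
  If the gap were not positive at \<open>x\<close>, it could not have increased throughout \<open>(0, x)\<close>; so the slope
  factor is nonpositive somewhere before \<open>x\<close> and hence negative from \<open>x\<close> on.  Then the gap would
  decrease strictly to its value at \<open>1\<close>, which is zero.
\<close>

lemma gap_end_weight_pos:
  assumes "0 < x" "x < 1"
  shows "0 < gap end_weight x"
proof (rule ccontr)
  let ?l = end_weight
  assume neg: "\<not> 0 < gap ?l x"
  have l: "0 \<le> ?l" "?l < 1/3" "?l < 1"
    using end_weight_pos end_weight_less_third by auto
  have "\<exists>z. 0 < z \<and> z < x \<and> slope_factor ?l (tilt z) \<le> 0"
  proof (rule ccontr)
    assume "\<not> ?thesis"
    then have "gap ?l 0 < gap ?l x"
      using l assms by (intro gap_greater) (auto simp: not_le)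
    with neg show False by simp
  qed
  then obtain z where z: "0 < z" "z < x" "slope_factor ?l (tilt z) \<le> 0" by blast
  have "gap ?l 1 < gap ?l x"
  proof (rule gap_less)
    fix y assume "x < y" "y < 1"
    then show "slope_factor ?l (tilt y) < 0"
      using z l assms tilt_gt_1[of z] tilt_less[of z y]
      by (intro slope_factor_stays_negative[of ?l "tilt z"]) auto
  qed (use l assms in auto)
  moreover have "gap ?l 1 = 0"
    using inverse_arsinh_1 l by (simp add: gap_def mix_1 field_simps)
  ultimately show False using neg by simp
qed

section \<open>The sharp weights\<close>

theorem theorem1p2:
  fixes \<alpha>\<^sub>2 \<beta>\<^sub>2 :: real
  shows "(\<forall>a b :: real. a > 0 \<longrightarrow> b > 0 \<longrightarrow> a \<noteq> b \<longrightarrow>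
            \<alpha>\<^sub>2 * geometric_mean a b + (1 - \<alpha>\<^sub>2) * quadratic_mean a b < neuman_sandor_mean a b \<and>
            neuman_sandor_mean a b < \<beta>\<^sub>2 * geometric_mean a b + (1 - \<beta>\<^sub>2) * quadratic_mean a b)
         \<longleftrightarrow> \<alpha>\<^sub>2 \<ge> 1 / 3 \<and> \<beta>\<^sub>2 \<le> 1 - 1 / (sqrt 2 * ln (1 + sqrt 2))"
  unfolding double_inequality_iff_mix end_weight_def[symmetric]
proof (intro iffI conjI allI impI)
  assume H: "\<forall>x. 0 < x \<longrightarrow> x < 1 \<longrightarrow> mix \<alpha>\<^sub>2 x < x / arsinh x \<and> x / arsinh x < mix \<beta>\<^sub>2 x"
  show "1 / 3 \<le> \<alpha>\<^sub>2"
  proof (rule ccontr)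
    assume "\<not> 1 / 3 \<le> \<alpha>\<^sub>2"
    then obtain x where "0 < x" "x < 1" "0 < gap \<alpha>\<^sub>2 x" using gap_pos_near_0[of \<alpha>\<^sub>2] by auto
    moreover have "\<alpha>\<^sub>2 < 1" using \<open>\<not> 1 / 3 \<le> \<alpha>\<^sub>2\<close> by simp
    ultimately show False using H quotient_arsinh_less_mix_iff(1)[of \<alpha>\<^sub>2 x] by force
  qed
  \<comment> \<open>The upper bound passes to the limit \<open>x = 1\<close>, where it compares \<open>end_weight\<close> with \<open>\<beta>\<^sub>2\<close>.\<close>
  have "isCont (\<lambda>x. x / arsinh x) (1::real)" "isCont (mix \<beta>\<^sub>2) 1"
    unfolding mix_def[abs_def] by (auto intro!: continuous_intros)
  then have "((\<lambda>x. x / arsinh x) \<longlongrightarrow> 1 / arsinh 1) (at_left (1::real))"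
    "(mix \<beta>\<^sub>2 \<longlongrightarrow> mix \<beta>\<^sub>2 1) (at_left 1)"
    by (auto simp: isCont_def filterlim_at_split)
  moreover have "\<forall>\<^sub>F x in at_left 1. x / arsinh x \<le> mix \<beta>\<^sub>2 x"
    using H by (intro eventually_at_leftI[of 0]) (auto intro: less_imp_le)
  ultimately have "1 / arsinh 1 \<le> mix \<beta>\<^sub>2 1"
    by (intro tendsto_le[OF trivial_limit_at_left_real])
  then show "\<beta>\<^sub>2 \<le> end_weight"
    unfolding inverse_arsinh_1 mix_1 by simp
next
  fix x :: real
  assume H: "1 / 3 \<le> \<alpha>\<^sub>2 \<and> \<beta>\<^sub>2 \<le> end_weight" and x: "0 < x" "x < 1"
  have "mix \<alpha>\<^sub>2 x \<le> mix (1/3) x" using H by (intro mix_antimono) simp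
  also have "\<dots> < x / arsinh x"
    using gap_third_neg[of x] quotient_arsinh_less_mix_iff(2)[of "1/3" x] x by simp
  finally show "mix \<alpha>\<^sub>2 x < x / arsinh x" .
  have "x / arsinh x < mix end_weight x"
    using gap_end_weight_pos[of x] quotient_arsinh_less_mix_iff(1)[of end_weight x]
      end_weight_less_third x by simp
  also have "\<dots> \<le> mix \<beta>\<^sub>2 x" using H by (intro mix_antimono) simp
  finally show "x / arsinh x < mix \<beta>\<^sub>2 x" .
qed

end
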